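(* Let $(s_n)_{n\ge 0}$ be a sequence over $\mathbb{F}_2$ whose generating function $G(x)=\sum_{n\ge 0}s_nx^n\in\mathbb{F}_2[[x]]$ satisfies $h(x,G(x))=0$ for a polynomial $h(x,y)\in\mathbb{F}_2[x,y]$. (i) If $h$ has the form \[ h(x,y)=f_2\big(y^{2^\ell}\big)+x\,f_1(y^2)+y+f_0(x) \] with polynomials $f_0,f_1,f_2$ over $\mathbb{F}_2$, $\deg f_0\le 2^\ell-3$, and an integer $\ell\ge 2$, then for every $N\ge 1$ \[ W(s_n,N)\ge \left\lfloor \frac{N+1}{2^\ell}\right\rfloor . \] (ii) If $h$ has the form \[ h(x,y)=f_1(x^2,y^2)+\big(x^{2^\ell}+1\big)y+f_0(x) \] with polynomials $f_1\in\mathbb{F}_2[x,y]$, $f_0\in\mathbb{F}_2[x]$, $\deg f_0\le 2^\ell-2$, and an integer $\ell\ge 1$, then for every $N\ge 1$ \[ W(s_n,N)\ge \left\lfloor \frac{N}{2^\ell}\right\rfloor . \]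
   Context: For a binary sequence $(s_n)$ (elements of $\mathbb{F}_2=\{0,1\}$, viewed as integers in exponents of $-1$), the $N$th well-distribution measure is \[ W(s_n,N)=\max_{a,b,t}\left|\sum_{j=0}^{t-1}(-1)^{s_{a+jb}}\right|, \] where the maximum is taken over all positive integers $b,t$ and integers $a\ge 0$ with $0\le a\le a+(t-1)b<N$. *)

theory Defs
  imports
    Complex_Main
    "HOL-Library.Z2"
    "HOL-Computational_Algebra.Polynomial"
    "HOL-Computational_Algebra.Formal_Power_Series"
begin

text \<open>The field with two elements is the type \<^typ>\<open>bit\<close>. The abbreviation
  \<open>of_bit\<close> maps its elements 0, 1 to the natural numbers 0, 1, which gives the exponents of -1.\<close>

definition well_dist_sums :: "(nat \<Rightarrow> bit) \<Rightarrow> nat \<Rightarrow> int set" where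
  "well_dist_sums s N =
     {\<bar>\<Sum>j<t. (-1) ^ (of_bit (s (a + j * b)) :: nat)\<bar> | a b t.
        0 < b \<and> 0 < t \<and> a + (t - 1) * b < N}"

definition well_dist :: "(nat \<Rightarrow> bit) \<Rightarrow> nat \<Rightarrow> int" where
  "well_dist s N = Max (well_dist_sums s N)"

text \<open>For positive \<open>N\<close> the maximum ranges over a finite nonempty set, so it is attained.\<close>

lemma finite_well_dist_sums: "finite (well_dist_sums s N)"
proof -
  have "well_dist_sums s N \<subseteq> {0..int N}"
  proof
    fix x assume "x \<in> well_dist_sums s N"
    then obtain a b t where x: "x = \<bar>\<Sum>j<t. (-1) ^ (of_bit (s (a + j * b)) :: nat)\<bar>"
      and b: "0 < b" "0 < t" "a + (t - 1) * b < N"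
      unfolding well_dist_sums_def by blast
    have "t - 1 \<le> (t - 1) * b" using b(1) by simp
    with b have "t \<le> N" by linarith
    moreover have "x \<le> (\<Sum>j<t. \<bar>(-1) ^ (of_bit (s (a + j * b)) :: nat)\<bar>)"
      unfolding x by (rule sum_abs)
    then have "x \<le> int t" by (simp add: power_abs)
    ultimately show "x \<in> {0..int N}" using x by simp
  qed
  then show ?thesis by (rule finite_subset) simp
qed

lemma well_dist_sums_nonempty:
  assumes "0 < N"
  shows "well_dist_sums s N \<noteq> {}"
proof -
  have "\<bar>\<Sum>j<1. (-1) ^ (of_bit (s (0 + j * 1)) :: nat)\<bar> \<in> well_dist_sums s N"
    unfolding well_dist_sums_def mem_Collect_eq
    by (rule exI[of _ 0], rule exI[of _ 1], rule exI[of _ 1]) (use assms in simp)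
  then show ?thesis by blast
qed

text \<open>Polynomials in \<open>x, y\<close> over \<open>'a\<close> are elements of \<open>'a poly poly\<close>: the outer variable is
  \<open>y\<close>, the coefficients are polynomials in \<open>x\<close>. The function \<open>\<phi>\<close> embeds the coefficient ring
  into the ring in which a polynomial is evaluated.\<close>

definition eval1 :: "('a::comm_ring_1 \<Rightarrow> 'b::comm_ring_1) \<Rightarrow> 'a poly \<Rightarrow> 'b \<Rightarrow> 'b" where
  "eval1 \<phi> f u = poly (map_poly \<phi> f) u"

definition eval2 :: "('a::comm_ring_1 \<Rightarrow> 'b::comm_ring_1) \<Rightarrow> 'a poly poly \<Rightarrow> 'b \<Rightarrow> 'b \<Rightarrow> 'b" where
  "eval2 \<phi> h u v = poly (map_poly (\<lambda>p. eval1 \<phi> p u) h) v"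

definition const2 :: "'a::comm_ring_1 \<Rightarrow> 'a poly poly" where
  "const2 c = [:[:c:]:]"

definition var_x :: "'a::comm_ring_1 poly poly" where
  "var_x = [:[:0, 1:]:]"

definition var_y :: "'a::comm_ring_1 poly poly" where
  "var_y = [:0, 1:]"

end

(* Over the field with two elements squaring is additive, so a polynomial expression in
   F^(2^k) is a power series in x^(2^k). Comparing coefficients at the exponents
   n = -2 (mod 2^l) in (i) and n = -1 (mod 2^l) in (ii) therefore kills the nonlinear terms:
   it gives s n = 0 in (i) and s (n + 2^l) = s n in (ii), starting from s (2^l - 1) = 0.
   The well-distribution sum along this progression has no cancellation. *)
theory Submission
  imports Defs
begin

unbundle fps_syntax

section \<open>Evaluation of polynomials in two variables\<close>

text \<open>Evaluation takes an arbitrary coefficient map \<open>\<phi>\<close>; only for a ring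
  homomorphism is it additive and multiplicative. The locale covers \<open>fps_const\<close>,
  \<open>const2\<close> and evaluation itself.\<close>

locale comm_ring_hom =
  fixes \<phi> :: "'a::comm_ring_1 \<Rightarrow> 'b::comm_ring_1"
  assumes hom_zero [simp]: "\<phi> 0 = 0"
    and hom_one [simp]: "\<phi> 1 = 1"
    and hom_add [simp]: "\<phi> (a + b) = \<phi> a + \<phi> b"
    and hom_mult [simp]: "\<phi> (a * b) = \<phi> a * \<phi> b"
begin

lemma hom_power [simp]: "\<phi> (a ^ n) = \<phi> a ^ n"
  by (induction n) simp_all

lemma eval1_0 [simp]: "eval1 \<phi> 0 u = 0"
  by (simp add: eval1_def)

lemma eval1_pCons [simp]: "eval1 \<phi> (pCons a p) u = \<phi> a + u * eval1 \<phi> p u"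
  by (simp add: eval1_def map_poly_pCons)

lemma eval1_add: "eval1 \<phi> (p + q) u = eval1 \<phi> p u + eval1 \<phi> q u"
  by (induction p q rule: poly_induct2) (simp_all add: algebra_simps)

lemma eval1_smult: "eval1 \<phi> (smult a p) u = \<phi> a * eval1 \<phi> p u"
  by (induction p) (simp_all add: algebra_simps)

lemma eval1_mult: "eval1 \<phi> (p * q) u = eval1 \<phi> p u * eval1 \<phi> q u"
  by (induction p) (simp_all add: eval1_add eval1_smult algebra_simps)

text \<open>This makes \<open>eval2\<close> an iterated \<open>eval1\<close>: the inner evaluation
  in \<open>x\<close> serves as the coefficient map of the outer one in \<open>y\<close>.\<close>

lemma comm_ring_hom_eval1: "comm_ring_hom (\<lambda>p. eval1 \<phi> p u)"
  by unfold_locales (simp_all add: eval1_add eval1_mult one_pCons)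

lemma eval2_eq_eval1: "eval2 \<phi> h u v = eval1 (\<lambda>p. eval1 \<phi> p u) h v"
  by (simp add: eval1_def eval2_def)

lemma comm_ring_hom_eval2: "comm_ring_hom (\<lambda>h. eval2 \<phi> h u v)"
  unfolding eval2_eq_eval1
  by (rule comm_ring_hom.comm_ring_hom_eval1[OF comm_ring_hom_eval1])

lemma eval2_const2 [simp]: "eval2 \<phi> (const2 c) u v = \<phi> c"
  using comm_ring_hom_eval1[of u]
  by (simp add: eval2_eq_eval1 const2_def comm_ring_hom.eval1_0 comm_ring_hom.eval1_pCons)

lemma eval2_var_x [simp]: "eval2 \<phi> var_x u v = u"
  using comm_ring_hom_eval1[of u]
  by (simp add: eval2_eq_eval1 var_x_def comm_ring_hom.eval1_0 comm_ring_hom.eval1_pCons)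

lemma eval2_var_y [simp]: "eval2 \<phi> var_y u v = v"
  using comm_ring_hom_eval1[of u]
  by (simp add: eval2_eq_eval1 var_y_def comm_ring_hom.eval1_0 comm_ring_hom.eval1_pCons
      comm_ring_hom.hom_one[of "\<lambda>p. eval1 \<phi> p u"])

end

lemma comm_ring_hom_fps_const: "comm_ring_hom fps_const"
  by unfold_locales simp_all

lemma comm_ring_hom_const2: "comm_ring_hom const2"
  by unfold_locales (simp_all add: const2_def one_pCons)

text \<open>Homomorphisms commute with the Horner recursion. With the two-variable analogue, this
  carries the substitution of \<open>fps_X\<close> and \<open>G\<close> into a polynomial built from
  \<open>var_x\<close> and \<open>var_y\<close>.\<close>

lemma comm_ring_hom_comp_eval1:
  assumes "comm_ring_hom \<psi>" "comm_ring_hom \<phi>"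
  shows "\<psi> (eval1 \<phi> p u) = eval1 (\<lambda>c. \<psi> (\<phi> c)) p (\<psi> u)"
proof -
  interpret \<psi>: comm_ring_hom \<psi> by fact
  interpret \<phi>: comm_ring_hom \<phi> by fact
  interpret c: comm_ring_hom "\<lambda>c. \<psi> (\<phi> c)" by unfold_locales simp_all
  show ?thesis by (induction p) simp_all
qed

lemma comm_ring_hom_comp_eval2:
  assumes "comm_ring_hom \<psi>" "comm_ring_hom \<phi>"
  shows "\<psi> (eval2 \<phi> h u v) = eval2 (\<lambda>c. \<psi> (\<phi> c)) h (\<psi> u) (\<psi> v)"
proof -
  have "comm_ring_hom (\<lambda>c. \<psi> (\<phi> c))"
    using assms by (simp add: comm_ring_hom_def)
  then show ?thesis
    using comm_ring_hom_comp_eval1[OF assms(1)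
        comm_ring_hom.comm_ring_hom_eval1[OF assms(2), of u], of h v]
    by (simp add: comm_ring_hom.eval2_eq_eval1[OF assms(2)]
        comm_ring_hom.eval2_eq_eval1[of "\<lambda>c. \<psi> (\<phi> c)"] comm_ring_hom_comp_eval1[OF assms])
qed

text \<open>Turns the degree bound on \<open>f0\<close> into vanishing coefficients of a power
  series.\<close>

lemma eval1_fps_X_nth: "eval1 fps_const f fps_X $ n = coeff f n"
proof -
  interpret comm_ring_hom fps_const by (rule comm_ring_hom_fps_const)
  show ?thesis
    by (induction f arbitrary: n) (auto simp: coeff_pCons split: nat.split)
qed

section \<open>Power series in a power of the variable\<close>

text \<open>The series in \<open>x ^ m\<close>, described by their support, so that single
  coefficients can be read off as zero.\<close>

definition fps_in_power :: "nat \<Rightarrow> 'a::zero fps \<Rightarrow> bool" where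
  "fps_in_power m F \<longleftrightarrow> (\<forall>n. \<not> m dvd n \<longrightarrow> F $ n = 0)"

lemma fps_in_power_0: "fps_in_power m 0"
  by (simp add: fps_in_power_def)

lemma fps_in_power_const: "fps_in_power m (fps_const c)"
  by (auto simp: fps_in_power_def)

lemma fps_in_power_X_power: "fps_in_power m (fps_X ^ m :: 'a::comm_ring_1 fps)"
  by (auto simp: fps_in_power_def fps_X_power_nth)

lemma fps_in_power_add:
  fixes F H :: "'a::monoid_add fps"
  shows "fps_in_power m F \<Longrightarrow> fps_in_power m H \<Longrightarrow> fps_in_power m (F + H)"
  by (simp add: fps_in_power_def)

text \<open>If \<open>m\<close> does not divide \<open>n\<close>, it cannot divide both
  \<open>i\<close> and \<open>n - i\<close>, so every term of the convolution has a zero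
  factor.\<close>

lemma fps_in_power_mult:
  fixes F H :: "'a::comm_ring_1 fps"
  assumes "fps_in_power m F" "fps_in_power m H"
  shows "fps_in_power m (F * H)"
  unfolding fps_in_power_def
proof (intro allI impI)
  fix n assume n: "\<not> m dvd n"
  have "F $ i * H $ (n - i) = 0" if "i \<in> {0..n}" for i
  proof (cases "m dvd i")
    case True
    with n that have "\<not> m dvd n - i"
      by (metis atLeastAtMost_iff dvd_diffD)
    with assms(2) show ?thesis by (simp add: fps_in_power_def)
  next
    case False
    with assms(1) show ?thesis by (simp add: fps_in_power_def)
  qed
  then show "(F * H) $ n = 0" by (simp add: fps_mult_nth)
qed

text \<open>The coefficient map stays general because the two-variable case needs it to be an inner
  evaluation, not just \<open>fps_const\<close>.\<close>

lemma fps_in_power_eval1: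
  assumes \<phi>: "comm_ring_hom \<phi>" and c: "\<And>c. fps_in_power m (\<phi> c)" and u: "fps_in_power m u"
  shows "fps_in_power m (eval1 \<phi> f u)"
proof -
  interpret comm_ring_hom \<phi> by fact
  show ?thesis
    by (induction f) (simp_all add: c u fps_in_power_0 fps_in_power_add fps_in_power_mult)
qed

lemma fps_in_power_eval1_const:
  "fps_in_power m u \<Longrightarrow> fps_in_power m (eval1 fps_const f u)"
  by (intro fps_in_power_eval1 comm_ring_hom_fps_const fps_in_power_const)

lemma fps_in_power_eval2_const:
  assumes "fps_in_power m u" "fps_in_power m v"
  shows "fps_in_power m (eval2 fps_const f u v)"
proof -
  interpret comm_ring_hom fps_const by (rule comm_ring_hom_fps_const)
  show ?thesis
    unfolding eval2_eq_eval1
    by (intro fps_in_power_eval1 comm_ring_hom_eval1 fps_in_power_eval1_const assms)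
qed

lemma bit_fps_add_self: "F + F = (0 :: bit fps)"
proof (rule fps_ext)
  fix n
  show "(F + F) $ n = 0 $ n"
    by (cases "F $ n") (simp_all only: fps_add_nth fps_zero_nth, simp_all)
qed

text \<open>The Frobenius identity F(x)^2 = F(x^2). Writing F = c + x H gives F^2 = c^2 + x^2 H^2,
  which reduces the coefficient at \<open>n\<close> to the one of H^2 at
  \<open>n - 2\<close>.\<close>

lemma bit_fps_square_nth: "(F ^ 2 :: bit fps) $ n = (if even n then F $ (n div 2) else 0)"
proof (induction n arbitrary: F rule: less_induct)
  case (less n)
  define H where "H = fps_shift 1 F"
  have "F = fps_const (F $ 0) + fps_X * H"
    by (simp add: H_def fps_eq_iff)
  then have "F ^ 2 = (fps_const (F $ 0) + fps_X * H) ^ 2" by simp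
  \<comment> \<open>The two equal cross terms are grouped so that they cancel in characteristic
    2.\<close>
  also have "\<dots> = fps_const (F $ 0) ^ 2 + fps_X * (fps_X * H ^ 2)
      + (fps_const (F $ 0) * fps_X * H + fps_const (F $ 0) * fps_X * H)"
    by (simp add: power2_eq_square algebra_simps)
  finally have sq: "F ^ 2 = fps_const (F $ 0 * F $ 0) + fps_X * (fps_X * H ^ 2)"
    by (simp add: bit_fps_add_self power2_eq_square)
  consider "n = 0" | "n = 1" | m where "n = Suc (Suc m)"
    by (metis One_nat_def old.nat.exhaust)
  then show ?case
  proof cases
    case 3
    with less.IH[of m H] show ?thesis by (simp add: sq H_def)
  qed (simp_all add: sq)
qed

text \<open>Iterated Frobenius: each squaring doubles all exponents in the support.\<close>

lemma fps_in_power_two_power: "fps_in_power (2 ^ k) (F ^ 2 ^ k :: bit fps)"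
proof (induction k)
  case 0
  show ?case by (simp add: fps_in_power_def)
next
  case (Suc k)
  have "(F ^ 2 ^ Suc k) $ n = 0" if n: "\<not> 2 ^ Suc k dvd n" for n
  proof (cases "even n")
    case True
    with n have "\<not> 2 ^ k dvd n div 2" by (auto elim!: evenE)
    with Suc True show ?thesis
      using bit_fps_square_nth[of "F ^ 2 ^ k" n]
      by (simp add: fps_in_power_def mult.commute flip: power_mult)
  next
    case False
    then show ?thesis
      using bit_fps_square_nth[of "F ^ 2 ^ k" n] by (simp add: mult.commute flip: power_mult)
  qed
  then show ?case by (simp add: fps_in_power_def)
qed

section \<open>Well-distribution along vanishing progressions\<close>

lemma well_dist_ge_if_progression_zero:
  assumes "0 < N" "0 < b" "\<And>j. s (a + j * b) = 0" "0 < t \<Longrightarrow> a + (t - 1) * b < N"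
  shows "int t \<le> well_dist s N"
proof -
  obtain x where x: "x \<in> well_dist_sums s N" using well_dist_sums_nonempty[OF assms(1)] by blast
  have "\<exists>y \<in> well_dist_sums s N. int t \<le> y"
  proof (cases "t = 0")
    case True
    have "0 \<le> x" using x by (auto simp: well_dist_sums_def)
    with x True show ?thesis by auto
  next
    case False
    have "\<bar>\<Sum>j<t. (-1) ^ (of_bit (s (a + j * b)) :: nat)\<bar> \<in> well_dist_sums s N"
      unfolding well_dist_sums_def mem_Collect_eq
      by (rule exI[of _ a], rule exI[of _ b], rule exI[of _ t]) (use assms False in simp)
    then show ?thesis by (auto simp: assms(3) intro: bexI)
  qed
  then show ?thesis
    unfolding well_dist_def using finite_well_dist_sums[of s N] by (meson Max_ge order_trans)
qed

lemma floor_divide_power_two: "\<lfloor>real n / 2 ^ l\<rfloor> = int (n div 2 ^ l)"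
  using floor_divide_of_nat_eq[of n "2 ^ l"] by simp

theorem theorem1:
  fixes s :: "nat \<Rightarrow> bit" and G :: "bit fps" and h :: "bit poly poly"
  assumes "G = Abs_fps s"
    and "eval2 fps_const h fps_X G = 0"
  shows "(\<forall>(l::nat) (f0::bit poly) (f1::bit poly) (f2::bit poly).
            2 \<le> l \<longrightarrow> degree f0 \<le> 2 ^ l - 3 \<longrightarrow>
            h = eval1 const2 f2 (var_y ^ (2 ^ l)) + var_x * eval1 const2 f1 (var_y ^ 2)
                  + var_y + eval1 const2 f0 var_x \<longrightarrow>
            (\<forall>N\<ge>1. well_dist s N \<ge> \<lfloor>(real N + 1) / 2 ^ l\<rfloor>)) \<and>
         (\<forall>(l::nat) (f0::bit poly) (f1::bit poly poly).
            1 \<le> l \<longrightarrow> degree f0 \<le> 2 ^ l - 2 \<longrightarrow>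
            h = eval2 const2 f1 (var_x ^ 2) (var_y ^ 2) + (var_x ^ (2 ^ l) + 1) * var_y
                  + eval1 const2 f0 var_x \<longrightarrow>
            (\<forall>N\<ge>1. well_dist s N \<ge> \<lfloor>real N / 2 ^ l\<rfloor>))"
proof (intro conjI allI impI)
  interpret c: comm_ring_hom "fps_const :: bit \<Rightarrow> bit fps" by (rule comm_ring_hom_fps_const)
  interpret e: comm_ring_hom "\<lambda>h. eval2 fps_const h fps_X G" by (rule c.comm_ring_hom_eval2)
  note eval_eval = comm_ring_hom_comp_eval1[OF e.comm_ring_hom_axioms comm_ring_hom_const2]
    comm_ring_hom_comp_eval2[OF e.comm_ring_hom_axioms comm_ring_hom_const2]
  have G_nth: "G $ n = s n" for n by (simp add: assms(1))
  {

    \<comment> \<open>Case (i): zeros of the sequence at indices -2 mod \<open>2 ^ l\<close>\<close>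
    fix l N :: nat and f0 f1 f2 :: "bit poly"
    assume l: "2 \<le> l" and deg: "degree f0 \<le> 2 ^ l - 3" and N: "1 \<le> N"
      and h: "h = eval1 const2 f2 (var_y ^ (2 ^ l)) + var_x * eval1 const2 f1 (var_y ^ 2)
                  + var_y + eval1 const2 f0 var_x"
    \<comment> \<open>Ensures 0 < \<open>2 ^ l - 2\<close> < \<open>2 ^ l\<close>, hence no
      divisibility by \<open>2 ^ l\<close>, and keeps the natural subtractions from
      truncating.\<close>
    have four: "(4::nat) \<le> 2 ^ l"
      using power_increasing[OF l, of "2::nat"] by simp
    have eq: "eval1 fps_const f2 (G ^ 2 ^ l) + fps_X * eval1 fps_const f1 (G ^ 2)
        + G + eval1 fps_const f0 fps_X = 0"
      using assms(2) by (simp add: h eval_eval)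
    have s0: "s (2 ^ l - 2 + j * 2 ^ l) = 0" for j
    proof -
      define n :: nat where "n = 2 ^ l - 2 + j * 2 ^ l"
      have "\<not> 2 ^ l dvd (2 ^ l - 2 :: nat)"
        using four by (intro nat_dvd_not_less) auto
      then have "\<not> 2 ^ l dvd n"
        by (metis n_def dvd_triv_right dvd_add_left_iff)
      then have f2: "eval1 fps_const f2 (G ^ 2 ^ l) $ n = 0"
        using fps_in_power_eval1_const[OF fps_in_power_two_power] by (auto simp: fps_in_power_def)
      \<comment> \<open>The factor \<open>fps_X\<close> shifts a series in \<open>x ^ 2\<close> to
        odd exponents, so this term vanishes at even \<open>n\<close>.\<close>
      have "0 < n" "even n" using four l by (auto simp: n_def)
      then have f1: "(fps_X * eval1 fps_const f1 (G ^ 2)) $ n = 0"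
        using fps_in_power_eval1_const[OF fps_in_power_two_power[of 1 G], of f1]
        by (auto simp: fps_in_power_def)
      have "degree f0 < n" using deg four by (simp add: n_def)
      then have f0: "eval1 fps_const f0 fps_X $ n = 0"
        by (simp add: eval1_fps_X_nth coeff_eq_0)
      show ?thesis
        using arg_cong[OF eq, of "\<lambda>F. F $ n"] f0 f1 f2 G_nth[of n] by (simp add: n_def)
    qed
    have "int ((N + 1) div 2 ^ l) \<le> well_dist s N"
    proof (rule well_dist_ge_if_progression_zero[where s = s, OF _ _ s0])
      let ?t = "(N + 1) div 2 ^ l"
      assume "0 < ?t"
      then obtain u where u: "?t = Suc u" by (metis gr0_implies_Suc)
      have "?t * 2 ^ l \<le> N + 1" by (rule div_times_less_eq_dividend)
      \<comment> \<open>The last index is \<open>?t * 2 ^ l - 2\<close>, at most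
        \<open>N - 1\<close>; starting two below a multiple of \<open>2 ^ l\<close> is what allows
        \<open>N + 1\<close> in the quotient.\<close>
      then show "2 ^ l - 2 + (?t - 1) * 2 ^ l < N"
        using four unfolding u by simp
    qed (use N in simp_all)
    then show "\<lfloor>(real N + 1) / 2 ^ l\<rfloor> \<le> well_dist s N"
      using floor_divide_power_two[of "N + 1" l] by (simp add: add.commute)
  }
  {

    \<comment> \<open>Case (ii): a recurrence along indices -1 mod \<open>2 ^ l\<close>\<close>
    fix l N :: nat and f0 :: "bit poly" and f1 :: "bit poly poly"
    assume l: "1 \<le> l" and deg: "degree f0 \<le> 2 ^ l - 2" and N: "1 \<le> N"
      and h: "h = eval2 const2 f1 (var_x ^ 2) (var_y ^ 2) + (var_x ^ (2 ^ l) + 1) * var_y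
                  + eval1 const2 f0 var_x"
    have two: "(2::nat) \<le> 2 ^ l"
      using power_increasing[OF l, of "2::nat"] by simp
    have eq: "eval2 fps_const f1 (fps_X ^ 2) (G ^ 2) + (fps_X ^ 2 ^ l * G + G)
        + eval1 fps_const f0 fps_X = 0"
      using assms(2) by (simp add: h eval_eval distrib_right)
    \<comment> \<open>Odd \<open>n\<close> removes the \<open>f1\<close> term, a series in
      \<open>x ^ 2\<close>, and the lower bound on \<open>n\<close> removes \<open>f0\<close>. The
      conditional is the coefficient of \<open>fps_X ^ 2 ^ l * G\<close>.\<close>
    have rec: "(if n < 2 ^ l then 0 else s (n - 2 ^ l)) + s n = 0"
      if "odd n" "2 ^ l - 1 \<le> n" for n
    proof -
      have f1: "eval2 fps_const f1 (fps_X ^ 2) (G ^ 2) $ n = 0"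
        using fps_in_power_eval2_const[OF fps_in_power_X_power[of 2]
            fps_in_power_two_power[of 1 G, simplified], of f1] \<open>odd n\<close>
        by (auto simp: fps_in_power_def)
      have "degree f0 < n" using deg two that(2) by linarith
      then have f0: "eval1 fps_const f0 fps_X $ n = 0"
        by (simp add: eval1_fps_X_nth coeff_eq_0)
      show ?thesis
        using arg_cong[OF eq, of "\<lambda>F. F $ n"] f0 f1
        by (simp add: G_nth fps_X_power_mult_nth split: if_splits)
    qed
    have odd: "odd (2 ^ l - 1 + j * 2 ^ l :: nat)" for j
      using two l by simp
    have s0: "s (2 ^ l - 1 + j * 2 ^ l) = 0" for j
    proof (induction j)
      case 0
      \<comment> \<open>The first index is still below \<open>2 ^ l\<close>, so the shifted term
        contributes 0 and the recurrence starts at zero.\<close>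
      show ?case using rec[OF odd[of 0]] by simp
    next
      case (Suc j)
      define n :: nat where "n = 2 ^ l - 1 + Suc j * 2 ^ l"
      have "2 ^ l - 1 \<le> n" "\<not> n < 2 ^ l" "n - 2 ^ l = 2 ^ l - 1 + j * 2 ^ l"
        by (simp_all add: n_def)
      with rec[of n] odd[of "Suc j"] Suc have "s n = 0" by (simp only: n_def) simp
      then show ?case by (simp only: n_def)
    qed
    have "int (N div 2 ^ l) \<le> well_dist s N"
    proof (rule well_dist_ge_if_progression_zero[where s = s, OF _ _ s0])
      let ?t = "N div 2 ^ l"
      assume "0 < ?t"
      then obtain u where u: "?t = Suc u" by (metis gr0_implies_Suc)
      have "?t * 2 ^ l \<le> N" by (rule div_times_less_eq_dividend)
      \<comment> \<open>Here the last index is \<open>?t * 2 ^ l - 1\<close>, again at most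
        \<open>N - 1\<close>.\<close>
      then show "2 ^ l - 1 + (?t - 1) * 2 ^ l < N"
        using two unfolding u by simp
    qed (use N in simp_all)
    then show "\<lfloor>real N / 2 ^ l\<rfloor> \<le> well_dist s N"
      by (simp add: floor_divide_power_two)
  }
qed

end
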